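(* Let $F$ be an algebraically closed field of characteristic different from $2$ and let $n\ge 2$. Let $G_n$ be the commutative algebra over $F$ with basis $x_1,\dots,x_n,e$ whose multiplication is given by $x_ix_j=0$ for all $1\le i,j\le n$, $x_1e=e+x_2$, $x_ie=x_i+x_{i+1}$ for $2\le i\le n-1$, $x_ne=x_n+x_1$, and $e^2=e$. Then the algebra $G_n$ is simple.
   Context: An algebra over $F$ is a vector space with a bilinear multiplication (not necessarily associative or unital). An algebra is simple if its multiplication is nonzero and it has no ideals other than $0$ and itself. *)

theory Defs
  imports "HOL-Computational_Algebra.Computational_Algebra"
begin

text \<open>
  An algebra in the sense of nonassociative algebra: a vector space with a bilinear
  multiplication, neither associative nor unital in general. The underlying space is a subspace
  \<open>A\<close> of the ambient space, so that algebras of different dimensions can live in one type; \<open>mult\<close> is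
  unconstrained outside \<open>A\<close>.
\<close>

locale nonassoc_algebra = vector_space scale
  for scale :: "'f::field \<Rightarrow> 'v::ab_group_add \<Rightarrow> 'v" (infixr \<open>*s\<close> 75) +
  fixes A :: "'v set"
    and mult :: "'v \<Rightarrow> 'v \<Rightarrow> 'v" (infixl \<open>\<cdot>\<close> 70)
  assumes subspace_carrier: "subspace A"
    and mult_closed: "\<lbrakk>a \<in> A; b \<in> A\<rbrakk> \<Longrightarrow> a \<cdot> b \<in> A"
    and mult_add_left: "\<lbrakk>a \<in> A; b \<in> A; c \<in> A\<rbrakk> \<Longrightarrow> (a + b) \<cdot> c = a \<cdot> c + b \<cdot> c"
    and mult_add_right: "\<lbrakk>a \<in> A; b \<in> A; c \<in> A\<rbrakk> \<Longrightarrow> a \<cdot> (b + c) = a \<cdot> b + a \<cdot> c"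
    and mult_scale_left: "\<lbrakk>a \<in> A; b \<in> A\<rbrakk> \<Longrightarrow> (r *s a) \<cdot> b = r *s (a \<cdot> b)"
    and mult_scale_right: "\<lbrakk>a \<in> A; b \<in> A\<rbrakk> \<Longrightarrow> a \<cdot> (r *s b) = r *s (a \<cdot> b)"
begin

definition ideal :: "'v set \<Rightarrow> bool" where
  "ideal I \<longleftrightarrow> subspace I \<and> I \<subseteq> A \<and> (\<forall>a\<in>A. \<forall>b\<in>I. a \<cdot> b \<in> I \<and> b \<cdot> a \<in> I)"

definition simple :: bool where
  "simple \<longleftrightarrow> (\<exists>a\<in>A. \<exists>b\<in>A. a \<cdot> b \<noteq> 0) \<and> (\<forall>I. ideal I \<longrightarrow> I = {0} \<or> I = A)"

end

text \<open>
  The algebra \<open>G\<^sub>n\<close>, given by a basis and its multiplication table; the products \<open>e \<cdot> x i\<close>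
  are determined by commutativity. Only the values \<open>x 1, \<dots>, x n\<close> of \<open>x\<close> are used.
\<close>

locale algebra_G = nonassoc_algebra scale A mult
  for scale :: "'f::field \<Rightarrow> 'v::ab_group_add \<Rightarrow> 'v" (infixr \<open>*s\<close> 75)
    and A :: "'v set"
    and mult :: "'v \<Rightarrow> 'v \<Rightarrow> 'v" (infixl \<open>\<cdot>\<close> 70) +
  fixes n :: nat
    and x :: "nat \<Rightarrow> 'v"
    and e :: 'v
  assumes mult_commute: "\<lbrakk>a \<in> A; b \<in> A\<rbrakk> \<Longrightarrow> a \<cdot> b = b \<cdot> a"
    and basis_inj: "inj_on x {1..n}" "e \<notin> x ` {1..n}"
    and basis_independent: "independent (insert e (x ` {1..n}))"
    and basis_span: "span (insert e (x ` {1..n})) = A"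
    and x_x: "\<lbrakk>i \<in> {1..n}; j \<in> {1..n}\<rbrakk> \<Longrightarrow> x i \<cdot> x j = 0"
    and x_first_e: "x 1 \<cdot> e = e + x 2"
    and x_e: "\<lbrakk>2 \<le> i; i \<le> n - 1\<rbrakk> \<Longrightarrow> x i \<cdot> e = x i + x (i + 1)"
    and x_last_e: "x n \<cdot> e = x n + x 1"
    and e_e: "e \<cdot> e = e"

text \<open>Over every field and for every \<open>n \<ge> 2\<close> the axioms of \<^locale>\<open>algebra_G\<close> have a model.\<close>

lemma algebra_G_exists:
  fixes n :: nat
  assumes n: "n \<ge> 2"
  shows "\<exists>(A :: 'f::field poly set) mult x e. algebra_G smult A mult n x e"
proof -
  interpret V: vector_space "smult :: 'f \<Rightarrow> _"
    by unfold_locales (auto simp: smult_add_right smult_add_left)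
  define x :: "nat \<Rightarrow> 'f poly" where "x i = monom 1 i" for i
  define t where "t i = (if i = 1 then x 0 + x 2 else if i = n then x n + x 1
                         else x i + x (i + 1))" for i
  define L where "L p = (\<Sum>i=1..n. smult (coeff p i) (t i))" for p
  define m where "m p q = smult (coeff p 0) (L q) + smult (coeff q 0) (L p)
                          + smult (coeff p 0 * coeff q 0) (x 0)" for p q
  define A where "A = {p :: 'f poly. degree p \<le> n}"
  have cx: "coeff (x i) j = (if i = j then 1 else 0)" for i j by (simp add: x_def)
  have L_add: "L (p + q) = L p + L q" for p q
    by (simp add: L_def smult_add_left sum.distrib)
  have L_smult: "L (smult c p) = smult c (L p)" for c p
    by (simp add: L_def V.scale_sum_right)
  have L_x: "L (x i) = (if i \<in> {1..n} then t i else 0)" for i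
    by (auto simp: L_def cx if_distrib[of "\<lambda>c. smult c _"] sum.delta cong: if_cong)
  have subA: "V.subspace A"
    by (auto simp: V.subspace_def A_def degree_add_le intro: order_trans[OF degree_smult_le])
  have xA: "i \<le> n \<Longrightarrow> x i \<in> A" for i by (auto simp: A_def x_def intro: order_trans[OF degree_monom_le])
  have tA: "i \<in> {1..n} \<Longrightarrow> t i \<in> A" for i
    using n by (auto simp: t_def intro!: V.subspace_add[OF subA] xA)
  have LA: "L p \<in> A" for p
    unfolding L_def by (intro V.subspace_sum[OF subA] V.subspace_scale[OF subA] tA)
  have inj: "inj x" by (auto simp: x_def inj_on_def monom_eq_iff')
  have ins: "insert (x 0) (x ` {1..n}) = x ` {0..n}"
    by (metis One_nat_def atLeastAtMost_insertL image_insert le0)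
  have indep: "V.independent (x ` {0..n})"
  proof (rule V.independent_if_scalars_zero)
    fix f :: "'f poly \<Rightarrow> 'f" and p
    assume s: "(\<Sum>p\<in>x ` {0..n}. smult (f p) p) = 0" and "p \<in> x ` {0..n}"
    then obtain j where j: "p = x j" "j \<le> n" by auto
    have "0 = coeff (\<Sum>i\<in>{0..n}. smult (f (x i)) (x i)) j"
      using s by (simp add: sum.reindex[OF inj_on_subset[OF inj]])
    also have "\<dots> = f (x j)"
      using j by (simp add: coeff_sum cx if_distrib[of "\<lambda>c. _ * c"] sum.delta' cong: if_cong)
    finally show "f p = 0" using j by simp
  qed simp
  have spn: "V.span (x ` {0..n}) = A"
  proof
    show "V.span (x ` {0..n}) \<subseteq> A"
      using xA by (intro V.span_minimal subA) auto
    show "A \<subseteq> V.span (x ` {0..n})"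
    proof
      fix p assume "p \<in> A"
      then have "p = (\<Sum>i\<in>{0..n}. smult (coeff p i) (x i))"
        using poly_as_sum_of_monoms'[of p n] 
        by (simp add: A_def x_def smult_monom atLeast0AtMost)
      also have "\<dots> \<in> V.span (x ` {0..n})"
        by (intro V.span_sum V.span_scale V.span_base) auto
      finally show "p \<in> V.span (x ` {0..n})" .
    qed
  qed
  have "algebra_G smult A m n x (x 0)"
  proof
    show "a \<in> A \<Longrightarrow> b \<in> A \<Longrightarrow> m a b \<in> A" for a b
      unfolding m_def
      by (intro V.subspace_add[OF subA] V.subspace_scale[OF subA] LA xA) auto
    show "inj_on x {1..n}" using inj by (rule inj_on_subset) simp
    show "x 0 \<notin> x ` {1..n}" using inj by (auto dest: injD)
    show "V.independent (insert (x 0) (x ` {1..n}))" unfolding ins by (rule indep)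
    show "V.span (insert (x 0) (x ` {1..n})) = A" unfolding ins by (rule spn)
  qed (use n in \<open>auto simp: subA m_def L_add L_smult L_x cx t_def
         smult_add_left smult_add_right algebra_simps\<close>)
  then show ?thesis by blast
qed

end

theory Submission
  imports Defs
begin

text \<open>
  Let \<open>I\<close> be a nonzero ideal of \<open>G\<^sub>n\<close>. Modulo the basis vector itself, multiplication by \<open>e\<close> moves the
  \<open>x i\<close> around the cycle \<open>x 1, x 2, \<dots>, x n, x 1\<close>, with the single exception that leaving \<open>x 1\<close> produces
  an \<open>e\<close>. So take a nonzero element of \<open>I\<close>. If its \<open>e\<close>-coordinate is \<open>0\<close>, then some \<open>x k\<close> occurs in
  it, and shifting \<open>x k\<close> around the cycle to \<open>x 1\<close> and then once more leads to an element of \<open>I\<close> with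
  nonzero \<open>e\<close>-coordinate (\<open>ideal_e_coordinate\<close>).

  Since all products \<open>x i \<cdot> x j\<close> vanish, multiplying an element whose \<open>e\<close>-coordinate is \<open>b \<noteq> 0\<close> by
  \<open>x i\<close> gives \<open>b\<close> times \<open>x i \<cdot> e\<close>. Hence all the products \<open>x i \<cdot> e\<close> lie in \<open>I\<close>. In particular
  \<open>x 1 \<cdot> e = e + x 2\<close> does, and so does its product with \<open>e\<close>, which is \<open>e + x 2 \<cdot> e\<close>. As \<open>x 2 \<cdot> e\<close>
  lies in \<open>I\<close>, so does \<open>e\<close>, and then \<open>x 2\<close> and, one after the other, all the \<open>x i\<close>
  (\<open>ideal_eq_carrier\<close>).
\<close>

context nonassoc_algebra
begin

lemma mult_zero_left: "b \<in> A \<Longrightarrow> 0 \<cdot> b = 0"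
  using mult_scale_left[of b b 0] by simp

lemma mult_sum_left:
  assumes "\<And>i. i \<in> S \<Longrightarrow> f i \<in> A" "b \<in> A"
  shows "(\<Sum>i\<in>S. f i) \<cdot> b = (\<Sum>i\<in>S. f i \<cdot> b)"
  using assms(1)
proof (induction S rule: infinite_finite_induct)
  case (insert i S)
  have "(\<Sum>i\<in>S. f i) \<in> A"
    using insert.prems by (intro subspace_sum[OF subspace_carrier]) auto
  then show ?case
    using insert assms(2) by (simp add: mult_add_left)
qed (simp_all add: mult_zero_left assms(2))

end

context algebra_G
begin

lemma e_in_carrier: "e \<in> A"
  unfolding basis_span[symmetric] by (intro span_base) simp

lemma x_in_carrier: "i \<in> {1..n} \<Longrightarrow> x i \<in> A"
  unfolding basis_span[symmetric] by (intro span_base) simp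

definition element :: "(nat \<Rightarrow> 'f) \<Rightarrow> 'f \<Rightarrow> 'v" where
  "element a b = (\<Sum>i=1..n. a i *s x i) + b *s e"

lemma x_part_in_carrier: "(\<Sum>i=1..n. a i *s x i) \<in> A"
  by (intro subspace_sum[OF subspace_carrier] subspace_scale[OF subspace_carrier] x_in_carrier)

lemma span_x_coordinates:
  assumes "v \<in> span (x ` {1..n})"
  obtains a where "v = (\<Sum>i=1..n. a i *s x i)"
proof -
  obtain u where "v = (\<Sum>w\<in>x ` {1..n}. u w *s w)"
    using assms unfolding span_finite[OF finite_imageI[OF finite_atLeastAtMost]]
    by (elim rangeE)
  then have "v = (\<Sum>i=1..n. u (x i) *s x i)"
    unfolding sum.reindex[OF basis_inj(1)] comp_def .
  then show thesis by (rule that)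
qed

lemma carrier_coordinates:
  assumes "v \<in> A"
  obtains a b where "v = element a b"
proof -
  obtain b where "v - b *s e \<in> span (x ` {1..n})"
    using assms unfolding basis_span[symmetric] span_breakdown_eq by (elim exE)
  then obtain a where "v - b *s e = (\<Sum>i=1..n. a i *s x i)"
    by (rule span_x_coordinates)
  then have "v = element a b"
    by (simp add: element_def algebra_simps)
  then show thesis by (rule that)
qed

lemma element_mult:
  assumes "c \<in> A"
  shows "element a b \<cdot> c = (\<Sum>i=1..n. a i *s (x i \<cdot> c)) + b *s (e \<cdot> c)"
proof -
  have "element a b \<cdot> c = (\<Sum>i=1..n. a i *s x i) \<cdot> c + (b *s e) \<cdot> c"
    unfolding element_def
    by (intro mult_add_left x_part_in_carrier subspace_scale[OF subspace_carrier]
        e_in_carrier assms)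
  also have "(\<Sum>i=1..n. a i *s x i) \<cdot> c = (\<Sum>i=1..n. (a i *s x i) \<cdot> c)"
    by (intro mult_sum_left subspace_scale[OF subspace_carrier] x_in_carrier assms)
  also have "\<dots> = (\<Sum>i=1..n. a i *s (x i \<cdot> c))"
    by (intro sum.cong refl mult_scale_left x_in_carrier assms)
  finally show ?thesis
    by (simp add: mult_scale_left e_in_carrier assms)
qed

lemma element_mult_x:
  assumes "j \<in> {1..n}"
  shows "element a b \<cdot> x j = b *s (x j \<cdot> e)"
  using assms
  by (simp add: element_mult x_in_carrier x_x mult_commute[OF e_in_carrier])

text \<open>
  This form of the multiplication table makes the cycle visible: every \<open>x i\<close> goes to its cyclic
  successor, and only the remainder, \<open>e\<close> or \<open>x i\<close>, depends on whether \<open>i = 1\<close>.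
\<close>

lemma x_mult_e:
  assumes "n \<ge> 2" "i \<in> {1..n}"
  shows "x i \<cdot> e = x (if i = n then 1 else i + 1) + (if i = 1 then e else x i)"
proof -
  consider "i = 1" | "i = n" "i \<noteq> 1" | "2 \<le> i" "i \<le> n - 1"
    using assms(2) by fastforce
  then show ?thesis
  proof cases
    case 1
    then show ?thesis
      using assms(1) x_first_e by (simp add: add.commute numeral_2_eq_2)
  next
    case 2
    then show ?thesis
      using x_last_e by (simp add: add.commute)
  next
    case 3
    then have "i \<noteq> n"
      using assms(1) by linarith
    with 3 show ?thesis
      using x_e[of i] by (simp add: add.commute)
  qed
qed

text \<open>
  Subtracting the identity turns multiplication by \<open>e\<close> into a cyclic shift of the coordinates, except
  that the coefficient of \<open>x 1\<close> also shows up as the new \<open>e\<close>-coordinate. The correction \<open>- a 1\<close>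
  arises because \<open>x 1 \<cdot> e\<close> contains \<open>e\<close> where the other products \<open>x i \<cdot> e\<close> contain \<open>x i\<close>.
\<close>

lemma element_mult_e_cyclic_shift:
  assumes "n \<ge> 2"
  shows "element a 0 \<cdot> e - element a 0
    = element (\<lambda>i. if i = 1 then a n - a 1 else a (i - 1)) (a 1)"
proof -
  let ?s = "\<lambda>i. if i = n then 1 else i + 1"
  let ?c = "\<lambda>j. if j = 1 then a n else a (j - 1)"
  have one: "1 \<in> {1..n}"
    using assms by simp
  have table: "a i *s (x i \<cdot> e)
      = a i *s x (?s i) + a i *s x i + (if i = 1 then a 1 *s (e - x 1) else 0)"
    if "i \<in> {1..n}" for i
    unfolding x_mult_e[OF assms that]
    by (simp add: scale_right_distrib scale_right_diff_distrib)
  have "element a 0 \<cdot> e = (\<Sum>i=1..n. a i *s (x i \<cdot> e))"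
    unfolding element_mult[OF e_in_carrier] by simp
  also have "\<dots> = (\<Sum>i=1..n. a i *s x (?s i) + a i *s x i
      + (if i = 1 then a 1 *s (e - x 1) else 0))"
    by (rule sum.cong[OF refl table])
  also have "\<dots> = (\<Sum>i=1..n. a i *s x (?s i)) + (\<Sum>i=1..n. a i *s x i) + a 1 *s (e - x 1)"
    unfolding sum.distrib using one by (simp add: sum.delta)
  also have "(\<Sum>i=1..n. a i *s x (?s i)) = (\<Sum>j=1..n. ?c j *s x j)"
    by (rule sum.reindex_bij_witness[of _ "\<lambda>j. if j = 1 then n else j - 1" ?s])
      (use assms in \<open>auto split: if_splits\<close>)
  finally have "element a 0 \<cdot> e - element a 0 = (\<Sum>j=1..n. ?c j *s x j) + a 1 *s (e - x 1)"
    by (simp add: element_def)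
  moreover have "(\<Sum>j=1..n. (if j = 1 then a n - a 1 else a (j - 1)) *s x j)
      = (\<Sum>j=1..n. ?c j *s x j - (if j = 1 then a 1 *s x 1 else 0))"
    by (intro sum.cong refl) (simp add: scale_left_diff_distrib)
  moreover have "\<dots> = (\<Sum>j=1..n. ?c j *s x j) - a 1 *s x 1"
    unfolding sum_subtractf using one by (simp add: sum.delta)
  ultimately show ?thesis
    by (simp add: element_def scale_right_diff_distrib)
qed

text \<open>
  If \<open>x 1\<close> occurs, one shift produces an \<open>e\<close>. Otherwise the shift moves the nonzero coordinate from
  position \<open>k\<close> to \<open>k + 1\<close>, or from \<open>n\<close> to \<open>1\<close>; therefore the induction runs downwards from
  \<open>k = n\<close>.
\<close>

lemma ideal_shift_to_e:
  assumes n: "n \<ge> 2" and I: "ideal I"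
    and k: "k \<in> {1..n}" "a k \<noteq> 0" and aI: "element a 0 \<in> I"
  shows "\<exists>a' b. element a' b \<in> I \<and> b \<noteq> 0"
proof -
  have shift: "element (\<lambda>i. if i = 1 then c n - c 1 else c (i - 1)) (c 1) \<in> I"
    if "element c 0 \<in> I" for c
  proof -
    have "element c 0 \<cdot> e - element c 0 \<in> I"
      using that I e_in_carrier subspace_diff by (auto simp: ideal_def)
    then show ?thesis
      unfolding element_mult_e_cyclic_shift[OF n] .
  qed
  have first: ?thesis if "element c 0 \<in> I" "c 1 \<noteq> 0" for c
    using shift that by blast
  have shift0: "element (\<lambda>i. if i = 1 then c n else c (i - 1)) 0 \<in> I"
    if "element c 0 \<in> I" "c 1 = 0" for c
    using shift[OF that(1)] by (simp only: that(2) diff_zero)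
  have "k \<le> n" using k by simp
  then have "element c 0 \<in> I \<Longrightarrow> c k \<noteq> 0 \<Longrightarrow> k \<ge> 1 \<Longrightarrow> ?thesis" for c
  proof (induction k arbitrary: c rule: inc_induct)
    case base
    show ?case
      using first[OF base(1)] first[OF shift0[OF base(1)]] base(2) by auto
  next
    case (step m)
    show ?case
      using first[OF step.prems(1)] step.IH[OF shift0[OF step.prems(1)]] step.prems by auto
  qed
  then show ?thesis
    using k aI by auto
qed

lemma ideal_e_coordinate:
  assumes n: "n \<ge> 2" and I: "ideal I" and "I \<noteq> {0}"
  shows "\<exists>a b. element a b \<in> I \<and> b \<noteq> 0"
proof -
  have "0 \<in> I" "I \<subseteq> A"
    using I subspace_0 by (auto simp: ideal_def)
  then obtain v where "v \<in> I" "v \<noteq> 0" "v \<in> A"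
    using \<open>I \<noteq> {0}\<close> by blast
  then obtain a b where ab: "element a b \<in> I" "element a b \<noteq> 0"
    by (metis carrier_coordinates)
  show ?thesis
  proof (cases "b = 0")
    case True
    then have "\<exists>k\<in>{1..n}. a k \<noteq> 0"
      using ab(2) by (force simp: element_def intro: sum.neutral)
    then show ?thesis
      using ideal_shift_to_e[OF n I] ab(1) True by blast
  qed (use ab in blast)
qed

lemma ideal_eq_carrier:
  assumes n: "n \<ge> 2" and I: "ideal I" and ab: "element a b \<in> I" "b \<noteq> 0"
  shows "I = A"
proof
  have sub: "subspace I" and mult_I: "\<And>c v. c \<in> A \<Longrightarrow> v \<in> I \<Longrightarrow> v \<cdot> c \<in> I"
    using I by (auto simp: ideal_def)
  have xe: "x j \<cdot> e \<in> I" if "j \<in> {1..n}" for j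
  proof -
    have "b *s (x j \<cdot> e) \<in> I"
      using mult_I[OF x_in_carrier[OF that] ab(1)] that by (simp add: element_mult_x)
    then have "inverse b *s b *s (x j \<cdot> e) \<in> I"
      by (rule subspace_scale[OF sub])
    then show ?thesis using ab(2) by simp
  qed
  have "e + x 2 \<in> I"
    using xe[of 1] n x_first_e by simp
  have "(e + x 2) \<cdot> e = e + x 2 \<cdot> e"
    using n by (simp add: mult_add_left e_in_carrier x_in_carrier e_e)
  then have "e + x 2 \<cdot> e \<in> I"
    using mult_I[OF e_in_carrier \<open>e + x 2 \<in> I\<close>] by simp
  then have eI: "e \<in> I"
    using subspace_diff[OF sub _ xe[of 2]] n by force
  have xI: "x j \<in> I" if "2 \<le> j" "j \<le> n" for j
    using that
  proof (induction j rule: dec_induct)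
    case base
    show ?case
      using subspace_diff[OF sub \<open>e + x 2 \<in> I\<close> eI] by simp
  next
    case (step j)
    then show ?case
      using subspace_diff[OF sub xe[of j], of "x j"] x_e[of j] by simp
  qed
  \<comment> \<open>The step from \<open>x n\<close> closes the cycle.\<close>
  have "x 1 \<in> I"
    using subspace_diff[OF sub xe[of n] xI[of n]] x_last_e n by simp
  then have "x j \<in> I" if "j \<in> {1..n}" for j
    using xI[of j] that by (cases "j = 1") auto
  then show "A \<subseteq> I"
    unfolding basis_span[symmetric] using eI by (intro span_minimal sub) auto
  show "I \<subseteq> A"
    using I by (simp add: ideal_def)
qed

end

theorem proposition6p1:
  fixes scale :: "'f::alg_closed_field \<Rightarrow> 'v::ab_group_add \<Rightarrow> 'v"
    and G :: "'v set"
    and mult :: "'v \<Rightarrow> 'v \<Rightarrow> 'v"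
    and n :: nat
    and x :: "nat \<Rightarrow> 'v"
    and e :: 'v
  assumes "CHAR('f) \<noteq> 2"
    and "n \<ge> 2"
    and "algebra_G scale G mult n x e"
  shows "nonassoc_algebra.simple scale G mult"
proof -
  interpret algebra_G scale G mult n x e
    by fact
  have "e \<noteq> 0"
    using basis_independent dependent_zero by blast
  then show ?thesis
    unfolding simple_def
    using e_in_carrier e_e ideal_e_coordinate[OF \<open>n \<ge> 2\<close>] ideal_eq_carrier[OF \<open>n \<ge> 2\<close>]
    by metis
qed

end
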